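(* Let $q\geq 1$ be an integer and $p=2q$. Let $X$ be a symmetric real random variable, not almost surely zero, with finite moments of all orders, let $X_1,X_2,\ldots,X_n$ be iid copies of $X$, and let $r_k=\frac{k!\,\mathbb{E}[X^{2k}]}{(2k)!}$ for $k\geq 0$. Let $a=(a_1,\ldots,a_n)\in\mathbb{R}^n$ satisfy $\sum_{k=1}^n a_k^2=1$ and put $S=\sum_{k=1}^n a_kX_k$. Then the following hold. (1) If $(r_k)_{k\ge 0}$ is log-concave, then $r_1r_{q-1}-r_q\geq 0$ and $$\|S\|_p^p\geq \Big(\frac{\|X\|_p}{\|X\|_2}\Big)^p\|S\|_2^p+2^q\gamma_p^p\,(r_1r_{q-1}-r_q)\Big(1-\sum_{k=1}^n a_k^p\Big).$$ (2) If $(r_k)_{k\ge 0}$ is log-convex, then $r_q-r_1r_{q-1}\geq 0$ and $$\|S\|_p^p\leq \Big(\frac{\|X\|_p}{\|X\|_2}\Big)^p\|S\|_2^p-2^q\gamma_p^p\,(r_q-r_1r_{q-1})\Big(1-\sum_{k=1}^n a_k^p\Big).$$ Moreover, the constants are asymptotically sharp near the coordinate extremizers $\pm e_i$, in the following sense: for $n\geq 2$ and $a=a(t)=(\sqrt{1-t^2},t,0,\ldots,0)$, the left-hand side and the right-hand side of the inequality in (1) (respectively (2)) differ by $O(t^4)$ as $t\to 0$.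
   Context: $\|Y\|_p=(\mathbb{E}|Y|^p)^{1/p}$ denotes the $L_p$ norm of a random variable $Y$, and $\gamma_p$ denotes the $L_p$ norm of a standard Gaussian random variable. A random variable $X$ is symmetric if $X$ and $-X$ have the same distribution. A sequence of positive numbers $(r_k)_{k\geq 0}$ is log-concave if $r_k^2\geq r_{k-1}r_{k+1}$ for all $k\geq 1$, and log-convex if $r_k^2\leq r_{k-1}r_{k+1}$ for all $k\geq 1$. The $e_i$ are the standard basis vectors of $\mathbb{R}^n$. *)

theory Defs
  imports "HOL-Probability.Probability" "HOL-Library.Landau_Symbols"
begin

definition Lp_norm :: "'a measure \<Rightarrow> real \<Rightarrow> ('a \<Rightarrow> real) \<Rightarrow> real" where
  "Lp_norm M p Y = (\<integral>\<omega>. \<bar>Y \<omega>\<bar> powr p \<partial>M) powr (1 / p)"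

definition gauss_norm :: "real \<Rightarrow> real" where
  "gauss_norm p = Lp_norm std_normal_distribution p (\<lambda>x. x)"

definition symmetric_rv :: "'a measure \<Rightarrow> ('a \<Rightarrow> real) \<Rightarrow> bool" where
  "symmetric_rv M X \<longleftrightarrow>
     X \<in> borel_measurable M \<and> distr M borel X = distr M borel (\<lambda>\<omega>. - X \<omega>)"

definition iid_copies ::
  "'b measure \<Rightarrow> 'i set \<Rightarrow> ('i \<Rightarrow> 'b \<Rightarrow> real) \<Rightarrow> 'a measure \<Rightarrow> ('a \<Rightarrow> real) \<Rightarrow> bool" where
  "iid_copies N I Xs M X \<longleftrightarrow>
     prob_space.indep_vars N (\<lambda>_. borel) Xs I \<and>
     (\<forall>i\<in>I. distr N borel (Xs i) = distr M borel X)"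

definition moment_ratio :: "'a measure \<Rightarrow> ('a \<Rightarrow> real) \<Rightarrow> nat \<Rightarrow> real" where
  "moment_ratio M X k = fact k * (\<integral>\<omega>. X \<omega> ^ (2 * k) \<partial>M) / fact (2 * k)"

definition log_concave_seq :: "(nat \<Rightarrow> real) \<Rightarrow> bool" where
  "log_concave_seq r \<longleftrightarrow>
     (\<forall>k. 0 < r k) \<and> (\<forall>k\<ge>1. r (k - 1) * r (k + 1) \<le> (r k)\<^sup>2)"

definition log_convex_seq :: "(nat \<Rightarrow> real) \<Rightarrow> bool" where
  "log_convex_seq r \<longleftrightarrow>
     (\<forall>k. 0 < r k) \<and> (\<forall>k\<ge>1. (r k)\<^sup>2 \<le> r (k - 1) * r (k + 1))"

text \<open>
  Positivity, which is part of both notions above, is no restriction for the sequences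
  to which they are applied here.
\<close>

lemma moment_ratio_pos:
  assumes nz: "\<not> (AE \<omega> in M. X \<omega> = 0)"
    and int: "\<And>k. integrable M (\<lambda>\<omega>. \<bar>X \<omega>\<bar> ^ k)"
  shows "0 < moment_ratio M X k"
proof -
  have eq: "(\<lambda>\<omega>. X \<omega> ^ (2 * k)) = (\<lambda>\<omega>. \<bar>X \<omega>\<bar> ^ (2 * k))"
    by (simp add: power_even_abs)
  have i: "integrable M (\<lambda>\<omega>. X \<omega> ^ (2 * k))"
    unfolding eq by (rule int)
  have "(\<integral>\<omega>. X \<omega> ^ (2 * k) \<partial>M) \<noteq> 0"
  proof
    assume "(\<integral>\<omega>. X \<omega> ^ (2 * k) \<partial>M) = 0"
    then have "AE \<omega> in M. X \<omega> ^ (2 * k) = 0"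
      using integral_nonneg_eq_0_iff_AE[OF i] by simp
    then have "AE \<omega> in M. X \<omega> = 0"
      by (rule AE_mp) (auto intro!: AE_I2)
    with nz show False by simp
  qed
  moreover have "0 \<le> (\<integral>\<omega>. X \<omega> ^ (2 * k) \<partial>M)"
    by simp
  ultimately have "0 < (\<integral>\<omega>. X \<omega> ^ (2 * k) \<partial>M)"
    by linarith
  then show ?thesis
    unfolding moment_ratio_def by (intro divide_pos_pos mult_pos_pos) simp_all
qed

text \<open>Vectors of \<open>\<real>\<^sup>n\<close> are functions on \<^typ>\<open>nat\<close> of which only the values on
  \<open>{1..n}\<close> matter.\<close>

definition weighted_sum :: "nat \<Rightarrow> (nat \<Rightarrow> real) \<Rightarrow> (nat \<Rightarrow> 'b \<Rightarrow> real) \<Rightarrow> 'b \<Rightarrow> real" where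
  "weighted_sum n a Xs = (\<lambda>\<omega>. \<Sum>k=1..n. a k * Xs k \<omega>)"

definition near_e1 :: "real \<Rightarrow> nat \<Rightarrow> real" where
  "near_e1 t = (\<lambda>k. if k = 1 then sqrt (1 - t\<^sup>2) else if k = 2 then t else 0)"

text \<open>
  The right-hand sides of the two inequalities, with \<open>p = 2 * q\<close>; \<open>X\<close> lives on \<open>M\<close>,
  its copies \<open>Xs\<close> on \<open>N\<close>.
\<close>

definition lower_bound ::
  "'a measure \<Rightarrow> ('a \<Rightarrow> real) \<Rightarrow> 'b measure \<Rightarrow> (nat \<Rightarrow> 'b \<Rightarrow> real) \<Rightarrow> nat \<Rightarrow> nat \<Rightarrow>
   (nat \<Rightarrow> real) \<Rightarrow> real" where
  "lower_bound M X N Xs n q a =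
    (let p = 2 * q; r = moment_ratio M X in
      (Lp_norm M p X / Lp_norm M 2 X) ^ p * (Lp_norm N 2 (weighted_sum n a Xs)) ^ p
      + 2 ^ q * gauss_norm p ^ p * (r 1 * r (q - 1) - r q) * (1 - (\<Sum>k=1..n. a k ^ p)))"

definition upper_bound ::
  "'a measure \<Rightarrow> ('a \<Rightarrow> real) \<Rightarrow> 'b measure \<Rightarrow> (nat \<Rightarrow> 'b \<Rightarrow> real) \<Rightarrow> nat \<Rightarrow> nat \<Rightarrow>
   (nat \<Rightarrow> real) \<Rightarrow> real" where
  "upper_bound M X N Xs n q a =
    (let p = 2 * q; r = moment_ratio M X in
      (Lp_norm M p X / Lp_norm M 2 X) ^ p * (Lp_norm N 2 (weighted_sum n a Xs)) ^ p
      - 2 ^ q * gauss_norm p ^ p * (r q - r 1 * r (q - 1)) * (1 - (\<Sum>k=1..n. a k ^ p)))"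

end

theory Submission
  imports Defs
begin

text \<open>
  Write \<open>x\<^sub>i = a\<^sub>i\<^sup>2\<close> and \<open>C = (2q)!/q!\<close>. Odd moments of \<open>X\<close> vanish, so expanding
  \<open>S\<^sup>2\<^sup>q\<close> by the multinomial theorem and taking expectations leaves only even exponents, and the
  normalisation in \<open>r\<close> is the one for which the coefficients become multinomial again:
  \<open>E S\<^sup>2\<^sup>q = C * (\<Sum>\<^bsub>|k| = q\<^esub> (q choose k\<^sub>1, ..., k\<^sub>n) * (\<Prod>i. x\<^sub>i ^ k\<^sub>i * r k\<^sub>i))\<close>
  (\<open>expectation_weighted_sum_power\<close>). When \<open>\<Sum>i. x\<^sub>i = 1\<close> the sum is the mean of
  \<open>\<Prod>i. r k\<^sub>i\<close> for a multinomially distributed \<open>k\<close>.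

  With probability \<open>\<Sum>i. x\<^sub>i ^ q\<close> all the mass \<open>q\<close> sits at one index, and the product is \<open>r q\<close>.
  Otherwise at least two of the \<open>k\<^sub>i\<close> are positive, and then log-concavity together with
  \<open>r 0 = 1\<close> gives \<open>r 1 * r (q - 1) \<le> (\<Prod>i. r k\<^sub>i)\<close>, since a product \<open>r j * r k\<close> grows as \<open>j\<close>
  and \<open>k\<close> move towards each other (\<open>log_concave_seq_spread\<close>). Hence the mean is at least
  \<open>r q * (\<Sum>i. x\<^sub>i ^ q) + r 1 * r (q - 1) * (1 - (\<Sum>i. x\<^sub>i ^ q))\<close>. Since \<open>\<parallel>S\<parallel>\<^sub>2 = \<parallel>X\<parallel>\<^sub>2\<close>,
  \<open>E X\<^sup>2\<^sup>q = C * r q\<close> and \<open>2\<^sup>q * \<gamma>\<^sub>p\<^sup>p = C\<close>, this quantity times \<open>C\<close> is the bound of the theorem.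
  In the log-convex case all the inequalities are reversed.

  For \<open>a = (sqrt (1 - t\<^sup>2), t, 0, ..., 0)\<close> the two sides differ by \<open>C\<close> times a sum over the outcomes
  \<open>k = (q - j, j)\<close> with \<open>0 < j < q\<close>. The outcome \<open>j = 1\<close> contributes nothing, its product being
  exactly \<open>r 1 * r (q - 1)\<close>, and the others have probability \<open>O(t\<^sup>2\<^sup>j)\<close> with \<open>j \<ge> 2\<close>.
\<close>

section \<open>Products of two terms of a log-concave or log-convex sequence\<close>

text \<open>Log-concavity says that the ratios \<open>r (k + 1) / r k\<close> decrease. Moving the outer
  index up by one multiplies by such a ratio at \<open>i + d + e\<close>, moving the inner one by the
  larger ratio at \<open>i + e\<close>.\<close>

lemma log_concave_seq_spread:
  assumes "log_concave_seq r"
  shows "r i * r (i + d + e) \<le> r (i + d) * r (i + e)"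
proof -
  have pos: "0 < r k" for k
    using assms by (simp add: log_concave_seq_def)
  define \<rho> where "\<rho> k = r (Suc k) / r k" for k
  have \<rho>: "r (Suc k) = r k * \<rho> k" "0 < \<rho> k" for k
    using pos[of k] pos[of "Suc k"] by (simp_all add: \<rho>_def)
  have "\<rho> (Suc k) \<le> \<rho> k" for k
  proof -
    have "r k * r (Suc (Suc k)) \<le> r (Suc k) * r (Suc k)"
      using assms unfolding log_concave_seq_def power2_eq_square
      by (metis Suc_eq_plus1 diff_Suc_1 le_add2)
    then show ?thesis
      using pos[of k] pos[of "Suc k"] by (simp add: \<rho>_def field_simps)
  qed
  then have dec: "\<rho> l \<le> \<rho> k" if "k \<le> l" for k l
    using that by (rule lift_Suc_antimono_le)
  show ?thesis
  proof (induction e)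
    case 0
    show ?case by simp
  next
    case (Suc e)
    have "r i * r (i + d + Suc e) = (r i * r (i + d + e)) * \<rho> (i + d + e)"
      by (simp add: \<rho>(1))
    also have "\<dots> \<le> (r (i + d) * r (i + e)) * \<rho> (i + e)"
      using pos[of "i + d"] pos[of "i + e"] \<rho>(2)[of "i + d + e"]
      by (intro mult_mono Suc.IH dec) simp_all
    also have "\<dots> = r (i + d) * r (i + Suc e)"
      by (simp add: \<rho>(1))
    finally show ?case .
  qed
qed

text \<open>The reciprocals of a log-convex sequence form a log-concave one.\<close>

lemma log_convex_seq_spread:
  assumes "log_convex_seq r"
  shows "r (i + d) * r (i + e) \<le> r i * r (i + d + e)"
proof -
  have pos: "0 < r k" for k
    using assms by (simp add: log_convex_seq_def)
  have "inverse (r (k - 1)) * inverse (r (k + 1)) \<le> (inverse (r k))\<^sup>2" if "k \<ge> 1" for k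
  proof -
    have "(r k)\<^sup>2 \<le> r (k - 1) * r (k + 1)"
      using assms that by (simp add: log_convex_seq_def)
    then have "inverse (r (k - 1) * r (k + 1)) \<le> inverse ((r k)\<^sup>2)"
      using pos[of k] by (intro le_imp_inverse_le) simp_all
    then show ?thesis
      by (simp add: power_inverse)
  qed
  then have "log_concave_seq (\<lambda>k. inverse (r k))"
    using pos by (simp add: log_concave_seq_def)
  from log_concave_seq_spread[OF this, of i d e]
  have "inverse (r i * r (i + d + e)) \<le> inverse (r (i + d) * r (i + e))"
    by simp
  then show ?thesis
    by (rule inverse_le_imp_le) (simp add: pos)
qed

section \<open>Multinomial means of products\<close>

text \<open>This is \<open>\<Sum>\<^bsub>k\<^sub>1 + ... + k\<^sub>n = q\<^esub> (q choose k\<^sub>1, ..., k\<^sub>n) * (\<Prod>i=1..n. x i ^ k\<^sub>i * r k\<^sub>i)\<close>,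
  arranged with the sum over \<open>k\<^sub>n\<close> outermost; the recursion is the one that the moments of a sum of
  independent variables satisfy.\<close>

fun multinomial_mean :: "(nat \<Rightarrow> real) \<Rightarrow> (nat \<Rightarrow> real) \<Rightarrow> nat \<Rightarrow> nat \<Rightarrow> real" where
  "multinomial_mean r x 0 q = (if q = 0 then 1 else 0)"
| "multinomial_mean r x (Suc n) q =
    (\<Sum>j\<le>q. real (q choose j) * x (Suc n) ^ j * r j * multinomial_mean r x n (q - j))"

lemma multinomial_mean_degree_0:
  "r 0 = 1 \<Longrightarrow> multinomial_mean r x n 0 = 1"
  by (induction n) simp_all

lemma multinomial_mean_degree_1:
  "r 0 = 1 \<Longrightarrow> multinomial_mean r x n 1 = r 1 * (\<Sum>k=1..n. x k)"
  by (induction n) (simp_all add: multinomial_mean_degree_0 algebra_simps)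

lemma multinomial_mean_1:
  "multinomial_mean r x 1 q = x 1 ^ q * r q"
proof -
  have "multinomial_mean r x 1 q
      = (\<Sum>j\<le>q. if j = q then x 1 ^ q * r q else 0)"
    unfolding One_nat_def multinomial_mean.simps by (intro sum.cong) auto
  then show ?thesis
    by simp
qed

lemma multinomial_mean_2:
  "multinomial_mean r x 2 q
    = (\<Sum>j\<le>q. real (q choose j) * x 2 ^ j * x 1 ^ (q - j) * (r j * r (q - j)))"
proof -
  have "multinomial_mean r x (Suc 1) q
      = (\<Sum>j\<le>q. real (q choose j) * x (Suc 1) ^ j * x 1 ^ (q - j) * (r j * r (q - j)))"
    by (simp only: multinomial_mean.simps(2) multinomial_mean_1 mult_ac)
  then show ?thesis
    by (simp only: Suc_1)
qed

lemma multinomial_mean_trailing_zeros: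
  assumes "r 0 = 1" "m \<le> n" "\<And>k. m < k \<Longrightarrow> x k = 0"
  shows "multinomial_mean r x n q = multinomial_mean r x m q"
  using assms(2)
proof (induction n rule: dec_induct)
  case (step n)
  have zero: "x (Suc n) = 0"
    using step.hyps by (intro assms(3)) simp
  have "multinomial_mean r x (Suc n) q
      = (\<Sum>j\<le>q. if j = 0 then multinomial_mean r x n q else 0)"
    unfolding multinomial_mean.simps zero
    using assms(1) by (intro sum.cong) (auto simp: power_0_left)
  then show ?case
    using step.IH by simp
qed simp

lemma sum_atMost_split_ends:
  fixes f :: "nat \<Rightarrow> real"
  assumes "1 \<le> q"
  shows "(\<Sum>j\<le>q. f j) = f 0 + f q + (\<Sum>j=1..<q. f j)"
proof -
  have "{..q} = insert 0 (insert q {1..<q})"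
    using assms by auto
  then show ?thesis
    using assms by simp
qed

text \<open>The value that \<open>multinomial_mean r x n q\<close> would have if every product over at least two
  nonzero exponents were equal to \<open>r 1 * r (q - 1)\<close>.\<close>

definition two_level_mean :: "(nat \<Rightarrow> real) \<Rightarrow> (nat \<Rightarrow> real) \<Rightarrow> nat \<Rightarrow> nat \<Rightarrow> real" where
  "two_level_mean r x n q =
    r q * (\<Sum>k=1..n. x k ^ q)
    + r 1 * r (q - 1) * ((\<Sum>k=1..n. x k) ^ q - (\<Sum>k=1..n. x k ^ q))"

lemma sum_powers_le_power_sum:
  fixes x :: "nat \<Rightarrow> real"
  assumes "\<And>k. 0 \<le> x k" "1 \<le> q"
  shows "(\<Sum>k=1..n. x k ^ q) \<le> (\<Sum>k=1..n. x k) ^ q"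
proof (induction n)
  case (Suc n)
  have "(\<Sum>k=1..n. x k) ^ q + x (Suc n) ^ q \<le> ((\<Sum>k=1..n. x k) + x (Suc n)) ^ q"
  proof -
    let ?s = "\<Sum>k=1..n. x k"
    have "0 \<le> (\<Sum>j=1..<q. real (q choose j) * x (Suc n) ^ j * ?s ^ (q - j))"
      using assms(1) by (intro sum_nonneg mult_nonneg_nonneg zero_le_power) simp_all
    then show ?thesis
      using assms(2) binomial_ring[of "x (Suc n)" ?s q]
      by (simp add: sum_atMost_split_ends add.commute)
  qed
  then show ?case
    using Suc.IH by simp
qed (use assms in simp)

text \<open>A sign \<open>\<sigma>\<close> covers both directions: \<open>\<sigma> = 1\<close> is for log-concave and \<open>\<sigma> = -1\<close> for log-convex
  sequences. The induction splits off the exponent \<open>j\<close> of the last variable. The extreme cases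
  \<open>j = 0\<close> and \<open>j = q\<close> are the induction hypothesis and the new pure power; for \<open>0 < j < q\<close> the
  crude consequence \<open>\<sigma> * r m * s ^ m \<le> \<sigma> * multinomial_mean r x n m\<close> of the induction
  hypothesis, with \<open>s\<close> the sum of the earlier variables, is enough, because such an outcome
  already has two nonzero blocks of exponents.\<close>

lemma two_level_mean_le_multinomial_mean:
  fixes r x :: "nat \<Rightarrow> real" and \<sigma> :: real
  assumes r0: "r 0 = 1" and r: "\<And>k. 0 \<le> r k" and x: "\<And>k. 0 \<le> x k"
    and spread: "\<And>i d e. \<sigma> * (r i * r (i + d + e)) \<le> \<sigma> * (r (i + d) * r (i + e))"
    and q: "1 \<le> q"
  shows "\<sigma> * two_level_mean r x n q \<le> \<sigma> * multinomial_mean r x n q"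
  using q
proof (induction n arbitrary: q)
  case 0
  then show ?case
    by (simp add: two_level_mean_def power_0_left)
next
  case (Suc n)
  define s where "s = (\<Sum>k=1..n. x k)"
  define y where "y = x (Suc n)"
  define P where "P q = (\<Sum>k=1..n. x k ^ q)" for q
  have s: "0 \<le> s" and y: "0 \<le> y"
    unfolding s_def y_def using x by (simp_all add: sum_nonneg)
  have crude: "\<sigma> * (r m * s ^ m) \<le> \<sigma> * multinomial_mean r x n m" if m: "1 \<le> m" for m
  proof -
    have "P m \<le> s ^ m"
      unfolding P_def s_def using x m by (rule sum_powers_le_power_sum)
    moreover have "\<sigma> * r m \<le> \<sigma> * (r 1 * r (m - 1))"
      using spread[of 0 1 "m - 1"] m r0 by simp
    ultimately have "(\<sigma> * r m) * (s ^ m - P m) \<le> (\<sigma> * (r 1 * r (m - 1))) * (s ^ m - P m)"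
      by (intro mult_right_mono) simp_all
    then have "\<sigma> * (r m * s ^ m) \<le> \<sigma> * two_level_mean r x n m"
      by (simp add: two_level_mean_def P_def s_def algebra_simps)
    also have "\<dots> \<le> \<sigma> * multinomial_mean r x n m"
      using m by (rule Suc.IH)
    finally show ?thesis .
  qed
  define mid where
    "mid = (\<Sum>j=1..<q. real (q choose j) * y ^ j * r j * multinomial_mean r x n (q - j))"
  have step: "multinomial_mean r x (Suc n) q = multinomial_mean r x n q + y ^ q * r q + mid"
    using Suc.prems r0
    by (simp add: sum_atMost_split_ends mid_def y_def multinomial_mean_degree_0)
  have binom: "(\<Sum>j=1..<q. real (q choose j) * y ^ j * s ^ (q - j)) = (s + y) ^ q - s ^ q - y ^ q"
    using binomial_ring[of y s q] Suc.prems
    by (simp add: sum_atMost_split_ends add.commute)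
  have "\<sigma> * (r 1 * r (q - 1)) * ((s + y) ^ q - s ^ q - y ^ q)
      = (\<Sum>j=1..<q. (real (q choose j) * y ^ j * s ^ (q - j)) * (\<sigma> * (r 1 * r (q - 1))))"
    by (simp only: binom[symmetric] sum_distrib_left mult.commute)
  also have "\<dots> \<le> (\<Sum>j=1..<q. (real (q choose j) * y ^ j * s ^ (q - j)) * (\<sigma> * (r j * r (q - j))))"
  proof (rule sum_mono, rule mult_left_mono)
    fix j assume j: "j \<in> {1..<q}"
    have "1 + (j - 1) + (q - j - 1) = q - 1" "1 + (j - 1) = j" "1 + (q - j - 1) = q - j"
      using j by auto
    then show "\<sigma> * (r 1 * r (q - 1)) \<le> \<sigma> * (r j * r (q - j))"
      using spread[of 1 "j - 1" "q - j - 1"] by metis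
  qed (use s y in simp)
  also have "\<dots> = (\<Sum>j=1..<q. (real (q choose j) * y ^ j * r j) * (\<sigma> * (r (q - j) * s ^ (q - j))))"
    by (simp add: mult_ac)
  also have "\<dots> \<le> (\<Sum>j=1..<q. (real (q choose j) * y ^ j * r j) * (\<sigma> * multinomial_mean r x n (q - j)))"
    using r y by (intro sum_mono mult_left_mono[OF crude]) auto
  also have "\<dots> = \<sigma> * mid"
    unfolding mid_def by (simp add: sum_distrib_left mult_ac)
  finally have mid: "\<sigma> * (r 1 * r (q - 1)) * ((s + y) ^ q - s ^ q - y ^ q) \<le> \<sigma> * mid" .
  have "\<sigma> * two_level_mean r x (Suc n) q
      = \<sigma> * two_level_mean r x n q + \<sigma> * (y ^ q * r q)
        + \<sigma> * (r 1 * r (q - 1)) * ((s + y) ^ q - s ^ q - y ^ q)"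
    by (simp add: two_level_mean_def s_def y_def algebra_simps)
  also have "\<dots> \<le> \<sigma> * multinomial_mean r x n q + \<sigma> * (y ^ q * r q) + \<sigma> * mid"
    using Suc.IH[OF Suc.prems] mid by simp
  also have "\<dots> = \<sigma> * multinomial_mean r x (Suc n) q"
    by (simp only: step distrib_left)
  finally show ?case .
qed

text \<open>The outcomes \<open>j = 0\<close> and \<open>j = q\<close> of the two-variable mean agree in both means, and so does
  \<open>j = 1\<close>; every other outcome carries a factor \<open>x 2 ^ j\<close> with \<open>j \<ge> 2\<close>.\<close>

lemma multinomial_mean_near_vertex:
  fixes r :: "nat \<Rightarrow> real"
  assumes r0: "r 0 = 1" and n: "2 \<le> n" and q: "1 \<le> q"
  obtains K where "\<And>x. \<lbrakk>\<And>k. 2 < k \<Longrightarrow> x k = 0; x 1 = 1 - x 2; 0 \<le> x 2; x 2 \<le> 1\<rbrakk> \<Longrightarrow>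
    \<bar>multinomial_mean r x n q - two_level_mean r x n q\<bar> \<le> K * (x 2)\<^sup>2"
proof
  define c where "c j = r j * r (q - j) - r 1 * r (q - 1)" for j
  fix x :: "nat \<Rightarrow> real"
  assume x: "\<And>k. 2 < k \<Longrightarrow> x k = 0" "x 1 = 1 - x 2" "0 \<le> x 2" "x 2 \<le> 1"
  define w where "w j = real (q choose j) * x 2 ^ j * x 1 ^ (q - j)" for j
  have sums: "(\<Sum>k=1..n. f (x k)) = f (x 1) + f (x 2)" if "f 0 = 0" for f :: "real \<Rightarrow> real"
  proof -
    have "(\<Sum>k=1..n. f (x k)) = (\<Sum>k\<in>{1,2}. f (x k))"
      using n x(1) that by (intro sum.mono_neutral_right) auto
    then show ?thesis by simp
  qed
  have "(\<Sum>k=1..n. x k) = 1"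
    using sums[of "\<lambda>y. y"] x(2) by simp
  moreover have "(\<Sum>k=1..n. x k ^ q) = x 1 ^ q + x 2 ^ q"
    using sums[of "\<lambda>y. y ^ q"] q by simp
  ultimately have two: "two_level_mean r x n q
      = r q * (x 1 ^ q + x 2 ^ q) + r 1 * r (q - 1) * (1 - (x 1 ^ q + x 2 ^ q))"
    by (simp add: two_level_mean_def)
  have "(\<Sum>j\<le>q. w j) = 1"
    using binomial_ring[of "x 2" "x 1" q] x(2) by (simp add: w_def)
  then have tot: "(\<Sum>j=1..<q. w j) = 1 - (x 1 ^ q + x 2 ^ q)"
    using q by (simp add: sum_atMost_split_ends w_def)
  have "multinomial_mean r x n q = multinomial_mean r x 2 q"
    using r0 n x(1) by (rule multinomial_mean_trailing_zeros)
  also have "\<dots> = (\<Sum>j\<le>q. w j * (r j * r (q - j)))"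
    by (simp add: multinomial_mean_2 w_def)
  also have "\<dots> = r q * (x 1 ^ q + x 2 ^ q) + (\<Sum>j=1..<q. w j * (r j * r (q - j)))"
    using q r0 by (simp add: sum_atMost_split_ends w_def algebra_simps)
  finally have "multinomial_mean r x n q - two_level_mean r x n q
      = (\<Sum>j=1..<q. w j * (r j * r (q - j))) - r 1 * r (q - 1) * (\<Sum>j=1..<q. w j)"
    by (simp only: two tot add_diff_cancel_left)
  also have "\<dots> = (\<Sum>j=1..<q. w j * c j)"
    by (simp add: c_def right_diff_distrib sum_subtractf sum_distrib_left mult_ac)
  finally have diff: "multinomial_mean r x n q - two_level_mean r x n q = (\<Sum>j=1..<q. w j * c j)" .
  have "\<bar>w j * c j\<bar> \<le> real (q choose j) * \<bar>c j\<bar> * (x 2)\<^sup>2" if j: "j \<in> {1..<q}" for j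
  proof (cases "j = 1")
    case True
    then show ?thesis by (simp add: c_def)
  next
    case False
    have "x 2 ^ j * x 1 ^ (q - j) \<le> (x 2)\<^sup>2 * 1"
      using False j x by (intro mult_mono power_decreasing power_le_one) auto
    then have "(real (q choose j) * \<bar>c j\<bar>) * (x 2 ^ j * x 1 ^ (q - j))
        \<le> (real (q choose j) * \<bar>c j\<bar>) * (x 2)\<^sup>2"
      by (intro mult_left_mono) auto
    moreover have "\<bar>w j * c j\<bar> = (real (q choose j) * \<bar>c j\<bar>) * (x 2 ^ j * x 1 ^ (q - j))"
      using x by (simp add: w_def abs_mult)
    ultimately show ?thesis by simp
  qed
  then have "(\<Sum>j=1..<q. \<bar>w j * c j\<bar>) \<le> (\<Sum>j=1..<q. real (q choose j) * \<bar>c j\<bar> * (x 2)\<^sup>2)"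
    by (rule sum_mono)
  with sum_abs[of "\<lambda>j. w j * c j" "{1..<q}"]
  have "\<bar>\<Sum>j=1..<q. w j * c j\<bar> \<le> (\<Sum>j=1..<q. real (q choose j) * \<bar>c j\<bar> * (x 2)\<^sup>2)"
    by (rule order_trans)
  then show "\<bar>multinomial_mean r x n q - two_level_mean r x n q\<bar>
      \<le> (\<Sum>j=1..<q. real (q choose j) * \<bar>r j * r (q - j) - r 1 * r (q - 1)\<bar>) * (x 2)\<^sup>2"
    unfolding diff by (simp only: sum_distrib_right c_def)
qed

section \<open>Moments of weighted sums\<close>

lemma sum_atMost_even:
  fixes f :: "nat \<Rightarrow> real"
  assumes "\<And>i. odd i \<Longrightarrow> f i = 0"
  shows "(\<Sum>i\<le>2 * q. f i) = (\<Sum>j\<le>q. f (2 * j))"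
  using assms by (induction q) simp_all

text \<open>The reason for the normalisation by \<open>k! / (2k)!\<close>: it turns the coefficients of the even
  terms in a binomial expansion of order \<open>2q\<close> into those of order \<open>q\<close>.\<close>

lemma binomial_even_normalised:
  assumes "j \<le> q"
  shows "real (2 * q choose (2 * j)) * (fact (2 * j) / fact j) * (fact (2 * (q - j)) / fact (q - j))
    = fact (2 * q) / fact q * real (q choose j)"
proof -
  have "real (2 * q choose (2 * j)) = fact (2 * q) / (fact (2 * j) * fact (2 * (q - j)))"
    using assms by (simp add: binomial_fact diff_mult_distrib2)
  moreover have "real (q choose j) = fact q / (fact j * fact (q - j))"
    using assms by (rule binomial_fact)
  ultimately show ?thesis
    by simp
qed

text \<open>The last summand is independent of the sum of the others, so the binomial expansion of the
  power turns into a convolution of moments, which is the recursion of \<open>multinomial_mean\<close>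
  once the terms of odd order, which are zero, are dropped.\<close>

lemma (in prob_space) expectation_weighted_sum_power:
  fixes Xs :: "nat \<Rightarrow> 'a \<Rightarrow> real"
  assumes indep: "indep_vars (\<lambda>_. borel) Xs {1..n}"
    and int: "\<And>i m. i \<in> {1..n} \<Longrightarrow> integrable M (\<lambda>\<omega>. Xs i \<omega> ^ m)"
    and odd: "\<And>i m. i \<in> {1..n} \<Longrightarrow> odd m \<Longrightarrow> expectation (\<lambda>\<omega>. Xs i \<omega> ^ m) = 0"
    and even: "\<And>i k. i \<in> {1..n} \<Longrightarrow>
      expectation (\<lambda>\<omega>. Xs i \<omega> ^ (2 * k)) = fact (2 * k) / fact k * r k"
  shows "integrable M (\<lambda>\<omega>. weighted_sum n a Xs \<omega> ^ m)"
    and "expectation (\<lambda>\<omega>. weighted_sum n a Xs \<omega> ^ (2 * q))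
      = fact (2 * q) / fact q * multinomial_mean r (\<lambda>k. (a k)\<^sup>2) n q"
proof -
  have "(\<forall>m. integrable M (\<lambda>\<omega>. weighted_sum n a Xs \<omega> ^ m)) \<and>
    (\<forall>q. expectation (\<lambda>\<omega>. weighted_sum n a Xs \<omega> ^ (2 * q))
      = fact (2 * q) / fact q * multinomial_mean r (\<lambda>k. (a k)\<^sup>2) n q)"
    using assms
  proof (induction n)
    case 0
    show ?case
      by (simp add: weighted_sum_def power_0_left prob_space)
  next
    case (Suc n)
    let ?S = "weighted_sum n a Xs" and ?Y = "\<lambda>\<omega>. a (Suc n) * Xs (Suc n) \<omega>"
    have "indep_vars (\<lambda>_. borel) Xs {1..n}"
      by (rule indep_vars_subset[OF Suc.prems(1)]) auto
    then have IH: "integrable M (\<lambda>\<omega>. ?S \<omega> ^ m)"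
      "expectation (\<lambda>\<omega>. ?S \<omega> ^ (2 * q))
        = fact (2 * q) / fact q * multinomial_mean r (\<lambda>k. (a k)\<^sup>2) n q" for m q
      using Suc.IH Suc.prems(2-4) by simp_all
    have "indep_vars (\<lambda>_. borel) (\<lambda>i \<omega>. a i * Xs i \<omega>) {1..Suc n}"
      by (rule indep_vars_compose2[OF Suc.prems(1)]) simp
    then have "indep_vars (\<lambda>_. borel) (\<lambda>i \<omega>. a i * Xs i \<omega>) (insert (Suc n) {1..n})"
      by (simp add: atLeastAtMostSuc_conv)
    then have "indep_var borel ?Y borel ?S"
      unfolding weighted_sum_def by (intro indep_vars_sum) simp_all
    then have ind: "indep_var borel (\<lambda>\<omega>. ?Y \<omega> ^ i) borel (\<lambda>\<omega>. ?S \<omega> ^ j)" for i j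
      using indep_var_compose[of borel ?Y borel ?S "\<lambda>y. y ^ i" borel "\<lambda>s. s ^ j" borel]
      by (simp add: comp_def)
    have intY: "integrable M (\<lambda>\<omega>. ?Y \<omega> ^ i)" for i
      using Suc.prems(2)[of "Suc n" i] by (simp add: power_mult_distrib)
    have intYS: "integrable M (\<lambda>\<omega>. ?Y \<omega> ^ i * ?S \<omega> ^ j)" for i j
      by (rule indep_var_integrable[OF ind intY IH(1)])
    have EYS: "expectation (\<lambda>\<omega>. ?Y \<omega> ^ i * ?S \<omega> ^ j)
        = a (Suc n) ^ i * expectation (\<lambda>\<omega>. Xs (Suc n) \<omega> ^ i) * expectation (\<lambda>\<omega>. ?S \<omega> ^ j)" for i j
      using indep_var_lebesgue_integral[OF ind intY IH(1), of i j]
      by (simp add: power_mult_distrib)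
    have expand: "weighted_sum (Suc n) a Xs \<omega> ^ m
        = (\<Sum>i\<le>m. real (m choose i) * (?Y \<omega> ^ i * ?S \<omega> ^ (m - i)))" for \<omega> m
      using binomial_ring[of "?Y \<omega>" "?S \<omega>" m]
      by (simp add: weighted_sum_def add.commute mult.assoc)
    have "integrable M (\<lambda>\<omega>. weighted_sum (Suc n) a Xs \<omega> ^ m)" for m
      unfolding expand by (intro Bochner_Integration.integrable_sum integrable_mult_right intYS)
    moreover have "expectation (\<lambda>\<omega>. weighted_sum (Suc n) a Xs \<omega> ^ (2 * q))
      = fact (2 * q) / fact q * multinomial_mean r (\<lambda>k. (a k)\<^sup>2) (Suc n) q" for q
    proof -
      have "expectation (\<lambda>\<omega>. weighted_sum (Suc n) a Xs \<omega> ^ (2 * q))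
        = (\<Sum>i\<le>2 * q. real (2 * q choose i) *
            (a (Suc n) ^ i * expectation (\<lambda>\<omega>. Xs (Suc n) \<omega> ^ i)
              * expectation (\<lambda>\<omega>. ?S \<omega> ^ (2 * q - i))))"
        unfolding expand
        by (subst Bochner_Integration.integral_sum) (simp_all only: intYS integrable_mult_right
            Bochner_Integration.integral_mult_right EYS)
      also have "\<dots> = (\<Sum>j\<le>q. real (2 * q choose (2 * j)) *
            (a (Suc n) ^ (2 * j) * expectation (\<lambda>\<omega>. Xs (Suc n) \<omega> ^ (2 * j))
              * expectation (\<lambda>\<omega>. ?S \<omega> ^ (2 * q - 2 * j))))"
        by (rule sum_atMost_even) (simp add: Suc.prems(3))
      also have "\<dots> = (\<Sum>j\<le>q. fact (2 * q) / fact q * (real (q choose j) * ((a (Suc n))\<^sup>2) ^ j * r j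
          * multinomial_mean r (\<lambda>k. (a k)\<^sup>2) n (q - j)))"
      proof (intro sum.cong refl)
        fix j assume "j \<in> {..q}"
        then have "j \<le> q" by simp
        have "real (2 * q choose (2 * j)) * (a (Suc n) ^ (2 * j)
              * expectation (\<lambda>\<omega>. Xs (Suc n) \<omega> ^ (2 * j)) * expectation (\<lambda>\<omega>. ?S \<omega> ^ (2 * q - 2 * j)))
          = (real (2 * q choose (2 * j)) * (fact (2 * j) / fact j) * (fact (2 * (q - j)) / fact (q - j)))
            * (((a (Suc n))\<^sup>2) ^ j * r j * multinomial_mean r (\<lambda>k. (a k)\<^sup>2) n (q - j))"
          using IH(2)[of "q - j"] Suc.prems(4)[of "Suc n" j]
          by (simp add: diff_mult_distrib2 power_mult)
        then show "real (2 * q choose (2 * j)) * (a (Suc n) ^ (2 * j)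
              * expectation (\<lambda>\<omega>. Xs (Suc n) \<omega> ^ (2 * j)) * expectation (\<lambda>\<omega>. ?S \<omega> ^ (2 * q - 2 * j)))
          = fact (2 * q) / fact q * (real (q choose j) * ((a (Suc n))\<^sup>2) ^ j * r j
            * multinomial_mean r (\<lambda>k. (a k)\<^sup>2) n (q - j))"
          unfolding binomial_even_normalised[OF \<open>j \<le> q\<close>] by (simp only: mult.assoc)
      qed
      finally show ?thesis
        by (simp only: multinomial_mean.simps sum_distrib_left)
    qed
    ultimately show ?case by blast
  qed
  then show "integrable M (\<lambda>\<omega>. weighted_sum n a Xs \<omega> ^ m)"
    "expectation (\<lambda>\<omega>. weighted_sum n a Xs \<omega> ^ (2 * q))
      = fact (2 * q) / fact q * multinomial_mean r (\<lambda>k. (a k)\<^sup>2) n q"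
    by blast+
qed

lemma symmetric_rv_odd_moment:
  assumes "symmetric_rv M X" "odd m"
  shows "(\<integral>\<omega>. X \<omega> ^ m \<partial>M) = 0"
proof -
  have X: "X \<in> borel_measurable M"
    and eq: "distr M borel X = distr M borel (\<lambda>\<omega>. - X \<omega>)"
    using assms(1) by (simp_all add: symmetric_rv_def)
  have "(\<integral>\<omega>. X \<omega> ^ m \<partial>M) = (\<integral>x. x ^ m \<partial>distr M borel X)"
    using X by (subst integral_distr) simp_all
  also have "\<dots> = (\<integral>\<omega>. (- X \<omega>) ^ m \<partial>M)"
    unfolding eq using X by (subst integral_distr) simp_all
  also have "\<dots> = - (\<integral>\<omega>. X \<omega> ^ m \<partial>M)"
    using assms(2) by simp
  finally show ?thesis by simp
qed

lemma Lp_norm_even_power: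
  assumes "1 \<le> q"
  shows "Lp_norm M (real (2 * q)) Y ^ (2 * q) = (\<integral>\<omega>. Y \<omega> ^ (2 * q) \<partial>M)"
proof -
  have "\<bar>y\<bar> powr real (2 * q) = y ^ (2 * q)" for y :: real
    using assms powr_realpow'[of "\<bar>y\<bar>" "2 * q"] by (simp add: power_even_abs)
  then have "Lp_norm M (real (2 * q)) Y = (\<integral>\<omega>. Y \<omega> ^ (2 * q) \<partial>M) powr (1 / real (2 * q))"
    by (simp only: Lp_norm_def)
  moreover have "0 \<le> (\<integral>\<omega>. Y \<omega> ^ (2 * q) \<partial>M)"
    by (intro integral_nonneg_AE) simp
  ultimately have "Lp_norm M (real (2 * q)) Y powr real (2 * q) = (\<integral>\<omega>. Y \<omega> ^ (2 * q) \<partial>M)"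
    using assms by (simp add: powr_powr)
  moreover have "0 \<le> Lp_norm M (real (2 * q)) Y"
    by (simp add: Lp_norm_def)
  ultimately show ?thesis
    using assms powr_realpow'[of "Lp_norm M (real (2 * q)) Y" "2 * q"] by simp
qed

lemma Lp_norm_2_power:
  "Lp_norm M 2 Y ^ (2 * q) = (\<integral>\<omega>. (Y \<omega>)\<^sup>2 \<partial>M) ^ q"
  using Lp_norm_even_power[of 1 M Y] by (simp add: power_mult)

lemma gauss_norm_even_power:
  assumes "1 \<le> q"
  shows "2 ^ q * gauss_norm (real (2 * q)) ^ (2 * q) = fact (2 * q) / fact q"
proof -
  have "(\<integral>x. x ^ (2 * q) \<partial>std_normal_distribution)
      = (\<integral>x. std_normal_density x * x ^ (2 * q) \<partial>lborel)"
    by (subst integral_density) (simp_all add: normal_density_nonneg)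
  also have "\<dots> = fact (2 * q) / (2 ^ q * fact q)"
    using std_normal_moment_even[of q] by (rule has_bochner_integral_integral_eq)
  finally show ?thesis
    unfolding gauss_norm_def Lp_norm_even_power[OF assms] by simp
qed

section \<open>The two inequalities and their sharpness\<close>

text \<open>In terms of \<open>multinomial_mean\<close> and \<open>two_level_mean\<close> the probabilistic content disappears:
  both bounds are the same expression, written with opposite signs.\<close>

lemma iid_copies_moments:
  fixes X :: "'a \<Rightarrow> real" and Xs :: "nat \<Rightarrow> 'b \<Rightarrow> real"
  assumes q: "1 \<le> q" and M: "prob_space M" and N: "prob_space N"
    and symmetric: "symmetric_rv M X"
    and nonzero: "\<not> (AE \<omega> in M. X \<omega> = 0)"
    and moments: "\<And>k::nat. integrable M (\<lambda>\<omega>. \<bar>X \<omega>\<bar> ^ k)"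
    and iid: "iid_copies N {1..n} Xs M X"
    and a: "(\<Sum>k=1..n. (a k)\<^sup>2) = 1"
  shows "Lp_norm N (real (2 * q)) (weighted_sum n a Xs) ^ (2 * q)
      = fact (2 * q) / fact q * multinomial_mean (moment_ratio M X) (\<lambda>k. (a k)\<^sup>2) n q"
    and "lower_bound M X N Xs n q a
      = fact (2 * q) / fact q * two_level_mean (moment_ratio M X) (\<lambda>k. (a k)\<^sup>2) n q"
    and "upper_bound M X N Xs n q a
      = fact (2 * q) / fact q * two_level_mean (moment_ratio M X) (\<lambda>k. (a k)\<^sup>2) n q"
proof -
  interpret M: prob_space M by (rule M)
  interpret N: prob_space N by (rule N)
  define r where "r = moment_ratio M X"
  define C where "C = (fact (2 * q) / fact q :: real)"
  have r0: "r 0 = 1"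
    by (simp add: r_def moment_ratio_def M.prob_space)
  have X[measurable]: "X \<in> borel_measurable M"
    using symmetric by (simp add: symmetric_rv_def)
  have dist: "distr N borel (Xs i) = distr M borel X" if "i \<in> {1..n}" for i
    using iid that by (simp add: iid_copies_def)
  have indep: "N.indep_vars (\<lambda>_. borel) Xs {1..n}"
    using iid by (simp add: iid_copies_def)
  have Xs: "Xs i \<in> borel_measurable N" if "i \<in> {1..n}" for i
    using indep that by (simp add: N.indep_vars_def)
  have moment_eq: "(\<integral>\<omega>. Xs i \<omega> ^ m \<partial>N) = (\<integral>\<omega>. X \<omega> ^ m \<partial>M)" if i: "i \<in> {1..n}" for i m
  proof -
    have "(\<integral>\<omega>. Xs i \<omega> ^ m \<partial>N) = (\<integral>x. x ^ m \<partial>distr N borel (Xs i))"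
      using Xs[OF i] by (subst integral_distr) simp_all
    also have "\<dots> = (\<integral>\<omega>. X \<omega> ^ m \<partial>M)"
      unfolding dist[OF i] by (subst integral_distr) simp_all
    finally show ?thesis .
  qed
  have intX: "integrable M (\<lambda>\<omega>. X \<omega> ^ m)" for m
    by (rule integrable_abs_cancel) (simp_all add: power_abs moments)
  have int: "integrable N (\<lambda>\<omega>. Xs i \<omega> ^ m)" if i: "i \<in> {1..n}" for i m
  proof -
    have "integrable (distr M borel X) (\<lambda>x. x ^ m)"
      using intX by (subst integrable_distr_eq) simp_all
    then show ?thesis
      unfolding dist[OF i, symmetric] using Xs[OF i] by (subst (asm) integrable_distr_eq) simp_all
  qed
  have even: "(\<integral>\<omega>. X \<omega> ^ (2 * k) \<partial>M) = fact (2 * k) / fact k * r k" for k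
    by (simp add: r_def moment_ratio_def)
  have ES: "(\<integral>\<omega>. weighted_sum n a Xs \<omega> ^ (2 * m) \<partial>N)
      = fact (2 * m) / fact m * multinomial_mean r (\<lambda>k. (a k)\<^sup>2) n m" for m
    by (rule N.expectation_weighted_sum_power(2)[OF indep int])
      (simp_all add: moment_eq even symmetric_rv_odd_moment[OF symmetric])
  show "Lp_norm N (real (2 * q)) (weighted_sum n a Xs) ^ (2 * q)
      = fact (2 * q) / fact q * multinomial_mean (moment_ratio M X) (\<lambda>k. (a k)\<^sup>2) n q"
    using q by (simp only: Lp_norm_even_power ES r_def)
  have "(\<integral>\<omega>. (weighted_sum n a Xs \<omega>)\<^sup>2 \<partial>N) = (\<integral>\<omega>. (X \<omega>)\<^sup>2 \<partial>M)"
    using ES[of 1] even[of 1] multinomial_mean_degree_1[of r "\<lambda>k. (a k)\<^sup>2" n] r0 a by simp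
  then have norm2: "Lp_norm N 2 (weighted_sum n a Xs) ^ (2 * q) = Lp_norm M 2 X ^ (2 * q)"
    by (simp only: Lp_norm_2_power)
  have "0 < r 1"
    unfolding r_def using nonzero moments by (rule moment_ratio_pos)
  then have "Lp_norm M 2 X ^ (2 * q) \<noteq> 0"
    using even[of 1] by (simp only: Lp_norm_2_power) simp
  then have main: "(Lp_norm M (real (2 * q)) X / Lp_norm M 2 X) ^ (2 * q)
      * Lp_norm N 2 (weighted_sum n a Xs) ^ (2 * q) = C * r q"
    by (simp only: power_divide norm2 Lp_norm_even_power[OF q] even C_def) simp
  have pw: "a k ^ (2 * q) = ((a k)\<^sup>2) ^ q" for k
    by (rule power_mult)
  show "lower_bound M X N Xs n q a
      = fact (2 * q) / fact q * two_level_mean (moment_ratio M X) (\<lambda>k. (a k)\<^sup>2) n q"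
    unfolding lower_bound_def Let_def r_def[symmetric] main gauss_norm_even_power[OF q]
      C_def[symmetric] two_level_mean_def a pw
    by (simp add: algebra_simps)
  show "upper_bound M X N Xs n q a
      = fact (2 * q) / fact q * two_level_mean (moment_ratio M X) (\<lambda>k. (a k)\<^sup>2) n q"
    unfolding upper_bound_def Let_def r_def[symmetric] main gauss_norm_even_power[OF q]
      C_def[symmetric] two_level_mean_def a pw
    by (simp add: algebra_simps)
qed

lemma sum_near_e1_squares:
  assumes "2 \<le> n" "\<bar>t\<bar> \<le> 1"
  shows "(\<Sum>k=1..n. (near_e1 t k)\<^sup>2) = 1"
proof -
  have "(\<Sum>k=1..n. (near_e1 t k)\<^sup>2) = (\<Sum>k\<in>{1,2}. (near_e1 t k)\<^sup>2)"
    using assms(1) by (intro sum.mono_neutral_right) (auto simp: near_e1_def)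
  then show ?thesis
    using assms(2) by (simp add: near_e1_def abs_square_le_1)
qed

theorem theorem1p2:
  fixes M :: "'a measure" and N :: "'b measure"
    and X :: "'a \<Rightarrow> real" and Xs :: "nat \<Rightarrow> 'b \<Rightarrow> real"
    and n q p :: nat and r :: "nat \<Rightarrow> real"
    and a :: "nat \<Rightarrow> real" and S :: "(nat \<Rightarrow> real) \<Rightarrow> 'b \<Rightarrow> real"
  assumes q: "1 \<le> q" and p: "p = 2 * q"
    and M: "prob_space M" and N: "prob_space N"
    and symmetric: "symmetric_rv M X"
    and nonzero: "\<not> (AE \<omega> in M. X \<omega> = 0)"
    and moments: "\<And>k::nat. integrable M (\<lambda>\<omega>. \<bar>X \<omega>\<bar> ^ k)"
    and iid: "iid_copies N {1..n} Xs M X"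
    and r: "r = moment_ratio M X"
    and a: "(\<Sum>k=1..n. (a k)\<^sup>2) = 1"
    and S: "S = (\<lambda>b. weighted_sum n b Xs)"
  shows
    "(log_concave_seq r \<longrightarrow>
        0 \<le> r 1 * r (q - 1) - r q \<and>
        Lp_norm N p (S a) ^ p \<ge> lower_bound M X N Xs n q a \<and>
        (2 \<le> n \<longrightarrow>
          (\<lambda>t. Lp_norm N p (S (near_e1 t)) ^ p - lower_bound M X N Xs n q (near_e1 t))
            \<in> O[at 0](\<lambda>t. t ^ 4))) \<and>
     (log_convex_seq r \<longrightarrow>
        0 \<le> r q - r 1 * r (q - 1) \<and>
        Lp_norm N p (S a) ^ p \<le> upper_bound M X N Xs n q a \<and>
        (2 \<le> n \<longrightarrow>
          (\<lambda>t. Lp_norm N p (S (near_e1 t)) ^ p - upper_bound M X N Xs n q (near_e1 t))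
            \<in> O[at 0](\<lambda>t. t ^ 4)))"
proof -
  interpret M: prob_space M by (rule M)
  define C where "C = (fact (2 * q) / fact q :: real)"
  have C: "0 < C"
    by (simp add: C_def)
  have r0: "r 0 = 1"
    by (simp add: r moment_ratio_def M.prob_space)
  have rpos: "0 \<le> r k" for k
    unfolding r using moment_ratio_pos[OF nonzero moments] by (simp add: less_imp_le)
  note moment_values = iid_copies_moments[OF q M N symmetric nonzero moments iid, folded r C_def]
  have sharp: "(\<lambda>t. Lp_norm N p (S (near_e1 t)) ^ p - B (near_e1 t)) \<in> O[at 0](\<lambda>t. t ^ 4)"
    if n: "2 \<le> n"
      and B: "\<And>b. (\<Sum>k=1..n. (b k)\<^sup>2) = 1 \<Longrightarrow> B b = C * two_level_mean r (\<lambda>k. (b k)\<^sup>2) n q"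
    for B :: "(nat \<Rightarrow> real) \<Rightarrow> real"
  proof -
    obtain K where K: "\<And>x. \<lbrakk>\<And>k. 2 < k \<Longrightarrow> x k = 0; x 1 = 1 - x 2; 0 \<le> x 2; x 2 \<le> 1\<rbrakk> \<Longrightarrow>
      \<bar>multinomial_mean r x n q - two_level_mean r x n q\<bar> \<le> K * (x 2)\<^sup>2"
      using multinomial_mean_near_vertex[where r = r and n = n and q = q] r0 n q by blast
    have "norm (Lp_norm N p (S (near_e1 t)) ^ p - B (near_e1 t)) \<le> (C * K) * norm (t ^ 4)"
      if t: "\<bar>t\<bar> \<le> 1" for t
    proof -
      let ?x = "\<lambda>k. (near_e1 t k)\<^sup>2"
      have t2: "t\<^sup>2 \<le> 1"
        using t by (simp add: abs_square_le_1)
      have sum1: "(\<Sum>k=1..n. ?x k) = 1"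
        using n t by (rule sum_near_e1_squares)
      have "\<bar>multinomial_mean r ?x n q - two_level_mean r ?x n q\<bar> \<le> K * (?x 2)\<^sup>2"
        using t2 by (intro K) (simp_all add: near_e1_def)
      then have "C * \<bar>multinomial_mean r ?x n q - two_level_mean r ?x n q\<bar> \<le> C * (K * (?x 2)\<^sup>2)"
        using C by (intro mult_left_mono) simp_all
      moreover have "(?x 2)\<^sup>2 = norm (t ^ 4)"
        by (simp add: near_e1_def flip: power_mult)
      moreover have "Lp_norm N p (S (near_e1 t)) ^ p - B (near_e1 t)
          = C * (multinomial_mean r ?x n q - two_level_mean r ?x n q)"
        unfolding S p moment_values(1)[OF sum1] B[OF sum1] by (simp add: right_diff_distrib)
      ultimately show ?thesis
        using C by (simp add: abs_mult)
    qed
    moreover have "eventually (\<lambda>t::real. \<bar>t\<bar> \<le> 1) (at 0)"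
      unfolding eventually_at by (rule exI[of _ 1]) (simp add: dist_real_def)
    ultimately show ?thesis
      by (intro bigoI[of _ "C * K"]) (auto elim: eventually_mono)
  qed
  have compare: "\<sigma> * r q \<le> \<sigma> * (r 1 * r (q - 1))"
    "\<sigma> * (C * two_level_mean r (\<lambda>k. (a k)\<^sup>2) n q) \<le> \<sigma> * Lp_norm N p (S a) ^ p"
    if spread: "\<And>i d e. \<sigma> * (r i * r (i + d + e)) \<le> \<sigma> * (r (i + d) * r (i + e))" for \<sigma>
  proof -
    show "\<sigma> * r q \<le> \<sigma> * (r 1 * r (q - 1))"
      using spread[of 0 1 "q - 1"] q r0 by simp
    have "\<sigma> * two_level_mean r (\<lambda>k. (a k)\<^sup>2) n q \<le> \<sigma> * multinomial_mean r (\<lambda>k. (a k)\<^sup>2) n q"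
      by (rule two_level_mean_le_multinomial_mean[OF r0 rpos _ spread q]) simp
    then have "C * (\<sigma> * two_level_mean r (\<lambda>k. (a k)\<^sup>2) n q)
        \<le> C * (\<sigma> * multinomial_mean r (\<lambda>k. (a k)\<^sup>2) n q)"
      by (rule mult_left_mono) (use C in simp)
    then show "\<sigma> * (C * two_level_mean r (\<lambda>k. (a k)\<^sup>2) n q) \<le> \<sigma> * Lp_norm N p (S a) ^ p"
      unfolding S p moment_values(1)[OF a] by (simp add: mult.left_commute)
  qed
  have "0 \<le> r 1 * r (q - 1) - r q" "Lp_norm N p (S a) ^ p \<ge> lower_bound M X N Xs n q a"
    if "log_concave_seq r"
    using compare[of 1] log_concave_seq_spread[OF that] moment_values(2)[OF a] by simp_all
  moreover have "0 \<le> r q - r 1 * r (q - 1)" "Lp_norm N p (S a) ^ p \<le> upper_bound M X N Xs n q a"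
    if "log_convex_seq r"
    using compare[of "-1"] log_convex_seq_spread[OF that] moment_values(3)[OF a] by simp_all
  ultimately show ?thesis
    using sharp[of "lower_bound M X N Xs n q"] sharp[of "upper_bound M X N Xs n q"] moment_values(2,3)
    by blast
qed

end
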